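(* Let $f\in\mathcal F^2$, $s>0$, $x_0\in\mathbb R^n$, and let $r$, $\beta$, $\gamma$ be real parameters with $\gamma\neq0$. Put $t_0=\frac{(r+1)\sqrt s}{2}$ and let $X_t$, $t\ge t_0$, be the solution of $$\ddot X_t+\frac{r+1}{t}\dot X_t+\frac\beta\gamma\sqrt s\,\nabla^2f(X_t)\dot X_t+\Big(1+\frac{(r+1)\sqrt s}{2t}\Big)\nabla f(X_t)=0,\qquad X(t_0)=x_0,\quad\dot X(t_0)=-\sqrt s\,\nabla f(x_0).$$ Define, for $t\ge t_0$, $$V_t=(t+C\sqrt s)\Big(t+\Big(\frac{r+1}2-\frac\beta\gamma\Big)\sqrt s\Big)(f(X_t)-f^* )+\frac{t+C\sqrt s}{t}\cdot\frac12\Big\|r(X_t-x^* )+t\Big(\dot X_t+\frac{\beta\sqrt s}{\gamma}\nabla f(X_t)\Big)\Big\|^2,$$ where $C=0$ if $r>2$ and $C=\frac\beta\gamma$ if $r=2$. If $r\ge2$ and $\frac\beta\gamma>0$, then there exists a time point $t_1\ge t_0$, with $t_1/\sqrt s$ depending only on $r$ and $\beta/\gamma$, such that for all $t>t_1$ $$f(X_t)-f^*=O\Big(\frac{V_{t_1}}{t^2}\Big),\qquad\inf_{t_1\le u\le t}\|\nabla f(X_u)\|^2=O\Big(\frac{\gamma V_{t_1}}{\beta\sqrt s\,(t^3-t_1^3)}\Big).$$ In addition, if $r\ge2$ and $\beta=0$, then (for some such $t_1$) the first bound still holds.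
   Context: $\mathcal F^2$ is the set of twice continuously differentiable convex functions $f:\mathbb R^n\to\mathbb R$. It is assumed throughout that $f$ has a minimizer; $x^*$ denotes one of the minimizers, $f^*=f(x^* )$, and $\|\cdot\|$ is the Euclidean norm. Here $g=O(h)$ means $g\le C'h$ for all $t>t_1$ with a constant $C'>0$ depending at most on $r$ and $\beta/\gamma$ (not on $f$, $x_0$, $s$, $t$). *)

theory Defs
  imports "HOL-Analysis.Analysis"
begin

text \<open>
  The constants in the theorem must not depend on the dimension, so \<open>n\<close> has to be quantified inside
  the formula, which the type \<open>real ^ 'n\<close> does not permit. All spaces \<open>\<real>\<^sup>n\<close> are therefore
  realised in one inner product space: the finitely supported real sequences with the inner product
  \<open>\<Sum>i. x\<^sub>i y\<^sub>i\<close>, in which \<open>\<real>\<^sup>n\<close> is the subspace of sequences vanishing from index \<open>n\<close> on.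
\<close>

typedef fseq = "{x :: nat \<Rightarrow> real. finite {i. x i \<noteq> 0}}"
  morphisms coord fseq_of
  by (rule exI[of _ "\<lambda>_. 0"]) simp

lemma finite_support: "finite {i. coord x i \<noteq> 0}"
  using coord[of x] by simp

lemma coord_fseq_of: "finite {i. x i \<noteq> 0} \<Longrightarrow> coord (fseq_of x) = x"
  by (simp add: fseq_of_inverse)

lemma fseq_eqI: "(\<And>i. coord x i = coord y i) \<Longrightarrow> x = y"
  using coord_inject by blast

instantiation fseq :: real_vector
begin

definition "0 = fseq_of (\<lambda>_. 0)"
definition "x + y = fseq_of (\<lambda>i. coord x i + coord y i)"
definition "- x = fseq_of (\<lambda>i. - coord x i)"
definition "x - y = fseq_of (\<lambda>i. coord x i - coord y i)"
definition "c *\<^sub>R x = fseq_of (\<lambda>i. c * coord x i)"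

lemma coord_zero [simp]: "coord 0 i = 0"
  by (simp add: zero_fseq_def coord_fseq_of)

lemma coord_add [simp]: "coord (x + y) i = coord x i + coord y i"
proof -
  have "finite {i. coord x i + coord y i \<noteq> 0}"
    by (rule finite_subset[OF _ finite_UnI[OF finite_support[of x] finite_support[of y]]]) auto
  then show ?thesis by (simp add: plus_fseq_def coord_fseq_of)
qed

lemma coord_minus [simp]: "coord (- x) i = - coord x i"
  using finite_support[of x] by (simp add: uminus_fseq_def coord_fseq_of)

lemma coord_diff [simp]: "coord (x - y) i = coord x i - coord y i"
proof -
  have "finite {i. coord x i - coord y i \<noteq> 0}"
    by (rule finite_subset[OF _ finite_UnI[OF finite_support[of x] finite_support[of y]]]) auto
  then show ?thesis by (simp add: minus_fseq_def coord_fseq_of)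
qed

lemma coord_scaleR [simp]: "coord (c *\<^sub>R x) i = c * coord x i"
proof -
  have "finite {i. c * coord x i \<noteq> 0}"
    by (rule finite_subset[OF _ finite_support[of x]]) auto
  then show ?thesis by (simp add: scaleR_fseq_def coord_fseq_of)
qed

instance
  by standard (rule fseq_eqI, simp add: algebra_simps)+

end

instantiation fseq :: real_inner
begin

definition "inner x y = (\<Sum>i | coord x i \<noteq> 0. coord x i * coord y i)"
definition "norm x = sqrt (inner x (x :: fseq))"
definition "dist x y = norm (x - y :: fseq)"
definition "sgn x = x /\<^sub>R norm (x :: fseq)"
definition [code del]:
  "(uniformity :: (fseq \<times> fseq) filter) = (INF e\<in>{0 <..}. principal {(x, y). dist x y < e})"
definition [code del]:
  "open (U :: fseq set) \<longleftrightarrow> (\<forall>x\<in>U. eventually (\<lambda>(x', y). x' = x \<longrightarrow> y \<in> U) uniformity)"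

lemma inner_fseq_eq_sum:
  assumes "finite S" "{i. coord x i \<noteq> 0} \<subseteq> S"
  shows "inner x y = (\<Sum>i\<in>S. coord x i * coord y i)"
  unfolding inner_fseq_def by (rule sum.mono_neutral_left) (use assms in auto)

instance
proof
  fix x y z :: fseq and c :: real
  define S where "S = {i. coord x i \<noteq> 0} \<union> {i. coord y i \<noteq> 0} \<union> {i. coord z i \<noteq> 0}"
  have S: "finite S" by (simp add: S_def finite_support)
  show "inner x y = inner y x"
    by (simp add: inner_fseq_eq_sum[OF S, of x] inner_fseq_eq_sum[OF S, of y] S_def subset_iff mult.commute)
  have "inner (x + y) z = (\<Sum>i\<in>S. coord (x + y) i * coord z i)"
    by (rule inner_fseq_eq_sum[OF S]) (auto simp: S_def)
  then show "inner (x + y) z = inner x z + inner y z"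
    by (simp add: inner_fseq_eq_sum[OF S, of x] inner_fseq_eq_sum[OF S, of y] S_def subset_iff
        distrib_right sum.distrib)
  have "inner (c *\<^sub>R x) y = (\<Sum>i\<in>S. coord (c *\<^sub>R x) i * coord y i)"
    by (rule inner_fseq_eq_sum[OF S]) (auto simp: S_def)
  then show "inner (c *\<^sub>R x) y = c * inner x y"
    by (simp add: inner_fseq_eq_sum[OF S, of x] S_def subset_iff sum_distrib_left mult.assoc)
  show "0 \<le> inner x x"
    by (simp add: inner_fseq_def sum_nonneg)
  show "inner x x = 0 \<longleftrightarrow> x = 0"
  proof
    assume "inner x x = 0"
    then have "\<forall>i\<in>{i. coord x i \<noteq> 0}. coord x i * coord x i = 0"
      unfolding inner_fseq_def by (subst (asm) sum_nonneg_eq_0_iff) (simp_all add: finite_support)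
    then show "x = 0" by (intro fseq_eqI) auto
  qed (simp add: inner_fseq_def)
qed (simp_all add: norm_fseq_def dist_fseq_def sgn_fseq_def uniformity_fseq_def open_fseq_def)

end

definition Rn :: "nat \<Rightarrow> fseq set" where
  "Rn n = {x. \<forall>i\<ge>n. coord x i = 0}"

text \<open>
  Differential calculus on a linear subspace \<open>E\<close>. A derivative within \<open>E\<close> is determined only on
  directions in \<open>E\<close>; hence gradients are required to lie in \<open>E\<close>, and \<open>hessian_on E f x v\<close> (the
  Hessian at \<open>x\<close> applied to \<open>v\<close>) is used for \<open>v \<in> E\<close> only.
\<close>

definition gradient_on :: "'a::real_inner set \<Rightarrow> ('a \<Rightarrow> real) \<Rightarrow> 'a \<Rightarrow> 'a" where
  "gradient_on E f x = (THE g. g \<in> E \<and> (f has_derivative (\<lambda>h. h \<bullet> g)) (at x within E))"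

definition hessian_on :: "'a::real_inner set \<Rightarrow> ('a \<Rightarrow> real) \<Rightarrow> 'a \<Rightarrow> 'a \<Rightarrow> 'a" where
  "hessian_on E f x v = frechet_derivative (gradient_on E f) (at x within E) v"

text \<open>For finite-dimensional \<open>E\<close>, continuity of \<open>x \<mapsto> \<nabla>\<^sup>2f(x) v\<close> for each \<open>v\<close> is continuity of \<open>\<nabla>\<^sup>2f\<close>.\<close>

definition twice_cont_diff_on :: "'a::real_inner set \<Rightarrow> ('a \<Rightarrow> real) \<Rightarrow> bool" where
  "twice_cont_diff_on E f \<longleftrightarrow>
     f differentiable_on E \<and> gradient_on E f differentiable_on E \<and>
     (\<forall>v\<in>E. continuous_on E (\<lambda>x. hessian_on E f x v))"

definition F2 :: "nat \<Rightarrow> (fseq \<Rightarrow> real) set" where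
  "F2 n = {f. twice_cont_diff_on (Rn n) f \<and> convex_on (Rn n) f}"

definition is_minimizer_on :: "'a set \<Rightarrow> ('a \<Rightarrow> real) \<Rightarrow> 'a \<Rightarrow> bool" where
  "is_minimizer_on E f x \<longleftrightarrow> x \<in> E \<and> (\<forall>y\<in>E. f x \<le> f y)"

definition start_time :: "real \<Rightarrow> real \<Rightarrow> real" where
  "start_time r s = (r + 1) * sqrt s / 2"

text \<open>\<open>X\<close> is a solution on \<open>[t\<^sub>0, \<infinity>)\<close> with velocity \<open>X'\<close>; derivatives at \<open>t\<^sub>0\<close> are one-sided.\<close>

definition ode_solution ::
  "nat \<Rightarrow> (fseq \<Rightarrow> real) \<Rightarrow> real \<Rightarrow> real \<Rightarrow> real \<Rightarrow> real \<Rightarrow> fseq \<Rightarrow> (real \<Rightarrow> fseq) \<Rightarrow> (real \<Rightarrow> fseq) \<Rightarrow> bool" where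
  "ode_solution n f r \<beta> \<gamma> s x0 X X' \<longleftrightarrow>
     (let t0 = start_time r s in
       X t0 = x0 \<and> X' t0 = - (sqrt s *\<^sub>R gradient_on (Rn n) f x0) \<and>
       (\<forall>t\<ge>t0. X t \<in> Rn n \<and>
          (X has_vector_derivative X' t) (at t within {t0..}) \<and>
          (\<exists>A. (X' has_vector_derivative A) (at t within {t0..}) \<and>
             A + ((r + 1) / t) *\<^sub>R X' t
               + (\<beta> / \<gamma> * sqrt s) *\<^sub>R hessian_on (Rn n) f (X t) (X' t)
               + (1 + (r + 1) * sqrt s / (2 * t)) *\<^sub>R gradient_on (Rn n) f (X t) = 0)))"

text \<open>Only the cases \<open>r > 2\<close> and \<open>r = 2\<close> are meaningful.\<close>

definition lyap_C :: "real \<Rightarrow> real \<Rightarrow> real \<Rightarrow> real" where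
  "lyap_C r \<beta> \<gamma> = (if r > 2 then 0 else \<beta> / \<gamma>)"

definition lyapunov ::
  "nat \<Rightarrow> (fseq \<Rightarrow> real) \<Rightarrow> real \<Rightarrow> real \<Rightarrow> real \<Rightarrow> real \<Rightarrow> fseq \<Rightarrow> (real \<Rightarrow> fseq) \<Rightarrow> (real \<Rightarrow> fseq) \<Rightarrow> real \<Rightarrow> real" where
  "lyapunov n f r \<beta> \<gamma> s xs X X' t =
     (let C = lyap_C r \<beta> \<gamma> in
       (t + C * sqrt s) * (t + ((r + 1) / 2 - \<beta> / \<gamma>) * sqrt s) * (f (X t) - f xs)
       + (t + C * sqrt s) / t * (1 / 2 *
           (norm (r *\<^sub>R (X t - xs)
                  + t *\<^sub>R (X' t + (\<beta> * sqrt s / \<gamma>) *\<^sub>R gradient_on (Rn n) f (X t))))\<^sup>2))"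

end

theory Submission
  imports Defs
begin

text \<open>
  Write \<open>b = \<beta>/\<gamma>\<close>, \<open>\<sigma> = sqrt s\<close>, \<open>c = (r + 1)/2 - b\<close>, \<open>g = \<nabla>f(X)\<close>. The differential equation says
  that \<open>Z = r(X - x\<^sup>*) + t(X' + b\<sigma>g)\<close> satisfies \<open>Z' = -(t + c\<sigma>)g\<close>. Together with the convexity
  inequality \<open>f(X) - f\<^sup>* \<le> g \<bullet> (X - x\<^sup>*)\<close> this gives, once \<open>t/\<sigma>\<close> exceeds a constant depending on \<open>r\<close>
  and \<open>b\<close> only, \<open>V' \<le> -(t + C\<sigma>)(t + c\<sigma>)b\<sigma>|g|\<^sup>2 \<le> -b\<sigma>t\<^sup>2|g|\<^sup>2/2\<close>. Since \<open>V \<ge> t\<^sup>2(f(X) - f\<^sup>*)/2\<close>,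
  monotonicity of \<open>V\<close> bounds \<open>f(X) - f\<^sup>*\<close>, and integrating \<open>V'\<close> bounds the gradient.
\<close>

section \<open>Linear algebra and gradients on \<open>Rn n\<close>\<close>

lemma subspace_Rn: "subspace (Rn n)"
  by (auto simp: subspace_def Rn_def)

definition unit_fseq :: "nat \<Rightarrow> fseq" where
  "unit_fseq i = fseq_of (\<lambda>j. if j = i then 1 else 0)"

lemma coord_unit_fseq: "coord (unit_fseq i) j = (if j = i then 1 else 0)"
  unfolding unit_fseq_def by (subst coord_fseq_of) auto

lemma coord_sum: "coord (\<Sum>i\<in>S. h i) j = (\<Sum>i\<in>S. coord (h i) j)"
  by (induction S rule: infinite_finite_induct) auto

lemma Rn_expansion:
  assumes "x \<in> Rn n"
  shows "x = (\<Sum>i<n. coord x i *\<^sub>R unit_fseq i)"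
proof (rule fseq_eqI)
  fix j
  have "(\<Sum>i<n. coord x i * (if j = i then 1 else 0)) = coord x j"
    using assms by (auto simp: Rn_def if_distrib cong: if_cong)
  then show "coord x j = coord (\<Sum>i<n. coord x i *\<^sub>R unit_fseq i) j"
    by (simp add: coord_sum coord_unit_fseq)
qed

text \<open>Riesz representation made explicit: the values of \<open>D\<close> on the unit vectors
  are the coordinates of the representing vector. Outside \<open>Rn n\<close> the two functionals
  may differ.\<close>

lemma linear_functional_representation_Rn:
  assumes "linear (D :: fseq \<Rightarrow> real)"
  obtains g where "g \<in> Rn n" "\<And>h. h \<in> Rn n \<Longrightarrow> D h = h \<bullet> g"
proof
  let ?a = "\<lambda>i. if i < n then D (unit_fseq i) else 0"
  have a: "coord (fseq_of ?a) = ?a"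
    by (rule coord_fseq_of) (rule finite_subset[of _ "{..<n}"], auto)
  show "fseq_of ?a \<in> Rn n"
    by (simp add: Rn_def a)
  fix h assume h: "h \<in> Rn n"
  have "D h = (\<Sum>i<n. coord h i * D (unit_fseq i))"
    by (subst Rn_expansion[OF h]) (simp add: linear_sum[OF assms] linear_cmul[OF assms])
  also have "\<dots> = h \<bullet> fseq_of ?a"
    using h by (subst inner_fseq_eq_sum[of "{..<n}"]) (auto simp: Rn_def a intro: ccontr)
  finally show "D h = h \<bullet> fseq_of ?a" .
qed

text \<open>The line through \<open>x\<close> in direction \<open>h\<close> stays in
  \<open>E\<close>, so a derivative within \<open>E\<close> becomes an ordinary one in a real
  variable. This serves both the uniqueness of gradients and the tangent inequality.\<close>

lemma has_derivative_within_subspace_line: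
  fixes f :: "'a::real_inner \<Rightarrow> real"
  assumes E: "subspace E" "x \<in> E" "h \<in> E" and f: "(f has_derivative D) (at x within E)"
  shows "((\<lambda>t. f (x + t *\<^sub>R h)) has_real_derivative D h) (at 0)"
proof -
  have "((\<lambda>t. x + t *\<^sub>R h) has_derivative (\<lambda>t. t *\<^sub>R h)) (at 0)"
    by (auto intro!: derivative_eq_intros)
  moreover have "range (\<lambda>t. x + t *\<^sub>R h) \<subseteq> E"
    using E by (auto intro: subspace_add subspace_scale)
  ultimately have "((\<lambda>t. f (x + t *\<^sub>R h)) has_derivative (\<lambda>t. D (t *\<^sub>R h))) (at 0)"
    using has_derivative_in_compose[of "\<lambda>t. x + t *\<^sub>R h" "\<lambda>t. t *\<^sub>R h" 0 UNIV f D]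
      has_derivative_subset[OF f] by simp
  then show ?thesis
    by (simp add: has_real_derivative_iff_has_vector_derivative has_vector_derivative_def
        linear_cmul[OF has_derivative_linear[OF f]])
qed

text \<open>\<open>gradient_on\<close> is a definite description, so existence and uniqueness must
  be shown before it carries information. Existence comes from representing a derivative by a
  vector, uniqueness from directional derivatives.\<close>

lemma gradient_on_Rn:
  assumes "f differentiable_on Rn n" "x \<in> Rn n"
  shows "gradient_on (Rn n) f x \<in> Rn n"
    and "(f has_derivative (\<lambda>h. h \<bullet> gradient_on (Rn n) f x)) (at x within Rn n)"
proof -
  obtain D where D: "(f has_derivative D) (at x within Rn n)"
    using assms by (auto simp: differentiable_on_def differentiable_def)
  obtain g where g: "g \<in> Rn n" "\<And>h. h \<in> Rn n \<Longrightarrow> D h = h \<bullet> g"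
    using linear_functional_representation_Rn[OF has_derivative_linear[OF D]] by blast
  \<comment> \<open>The limit within \<open>Rn n\<close> sees \<open>D\<close> only at differences
    \<open>y - x\<close> in \<open>Rn n\<close>, where it agrees with the inner product with
    \<open>g\<close>.\<close>
  have "eventually (\<lambda>y. ((f y - f x) - D (y - x)) /\<^sub>R norm (y - x)
      = ((f y - f x) - (y - x) \<bullet> g) /\<^sub>R norm (y - x)) (at x within Rn n)"
    unfolding eventually_at_filter
    by (rule always_eventually) (use g(2) subspace_diff[OF subspace_Rn _ assms(2)] in auto)
  with D have fg: "(f has_derivative (\<lambda>h. h \<bullet> g)) (at x within Rn n)"
    unfolding has_derivative_at_within
    by (auto intro: bounded_linear_inner_left Lim_transform_eventually)
  have "\<exists>!g. g \<in> Rn n \<and> (f has_derivative (\<lambda>h. h \<bullet> g)) (at x within Rn n)"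
  proof (rule ex1I[of _ g])
    fix g' assume g': "g' \<in> Rn n \<and> (f has_derivative (\<lambda>h. h \<bullet> g')) (at x within Rn n)"
    then have h: "g - g' \<in> Rn n"
      using g(1) by (auto intro: subspace_diff subspace_Rn)
    \<comment> \<open>Both sides are the derivative of \<open>f\<close> along the direction
      \<open>g - g'\<close>; equality forces this vector to have norm zero.\<close>
    have "(g - g') \<bullet> g = (g - g') \<bullet> g'"
      by (rule DERIV_unique[OF has_derivative_within_subspace_line[OF subspace_Rn assms(2) h fg]
            has_derivative_within_subspace_line[OF subspace_Rn assms(2) h conjunct2[OF g']]])
    then have "(g - g') \<bullet> (g - g') = 0"
      by (simp add: inner_diff_right)
    then show "g' = g" by simp
  qed (use g fg in blast)
  from theI'[OF this] show "gradient_on (Rn n) f x \<in> Rn n"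
    and "(f has_derivative (\<lambda>h. h \<bullet> gradient_on (Rn n) f x)) (at x within Rn n)"
    unfolding gradient_on_def by blast+
qed

text \<open>Restriction to the line through \<open>x\<close> and \<open>y\<close> reduces this to a
  convex function of one real variable, compared with its tangent at parameter 0.\<close>

lemma convex_on_subspace_above_tangent:
  fixes f :: "'a::real_inner \<Rightarrow> real"
  assumes E: "subspace E" "x \<in> E" "y \<in> E" and f: "(f has_derivative D) (at x within E)"
    and conv: "convex_on E f"
  shows "D (y - x) \<le> f y - f x"
proof -
  let ?\<phi> = "\<lambda>t. f (x + t *\<^sub>R (y - x))"
  have mem: "x + t *\<^sub>R (y - x) \<in> E" for t
    using E by (intro subspace_add subspace_scale subspace_diff)
  have "convex_on UNIV ?\<phi>"
  proof (rule convex_onI)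
    fix t a b :: real assume t: "0 < t" "t < 1"
    have "x + ((1 - t) *\<^sub>R a + t *\<^sub>R b) *\<^sub>R (y - x)
        = (1 - t) *\<^sub>R (x + a *\<^sub>R (y - x)) + t *\<^sub>R (x + b *\<^sub>R (y - x))"
      by (simp add: algebra_simps)
    then show "?\<phi> ((1 - t) *\<^sub>R a + t *\<^sub>R b) \<le> (1 - t) * ?\<phi> a + t * ?\<phi> b"
      using convex_onD[OF conv, of t, OF _ _ mem mem] t by simp
  qed simp
  then have "D (y - x) * (1 - 0) \<le> ?\<phi> 1 - ?\<phi> 0"
    by (rule convex_on_imp_above_tangent)
      (use has_derivative_within_subspace_line[OF E(1,2) subspace_diff[OF E(1,3,2)] f] in auto)
  then show ?thesis by simp
qed

section \<open>The Lyapunov function and its derivative\<close>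

text \<open>This is \<open>lyapunov\<close> with the objective gap and the gradient along the
  trajectory abstracted to functions \<open>F\<close> and \<open>G\<close> of time, so that
  differentiating it is calculus in one real variable.\<close>

definition energy ::
  "real \<Rightarrow> real \<Rightarrow> real \<Rightarrow> real \<Rightarrow> real \<Rightarrow> (real \<Rightarrow> real) \<Rightarrow> (real \<Rightarrow> 'a) \<Rightarrow> (real \<Rightarrow> 'a)
    \<Rightarrow> (real \<Rightarrow> 'a) \<Rightarrow> 'a::real_inner \<Rightarrow> real \<Rightarrow> real" where
  "energy r b C c \<sigma> F X X' G xs t =
     (t + C * \<sigma>) * (t + c * \<sigma>) * F t
     + (t + C * \<sigma>) / t * (1 / 2 * (norm (r *\<^sub>R (X t - xs) + t *\<^sub>R (X' t + (b * \<sigma>) *\<^sub>R G t)))\<^sup>2)"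

text \<open>The derivative of \<open>F\<close> and the inner product of \<open>G t\<close> with the
  vector inside the norm both produce a multiple of \<open>X' t \<bullet> G t\<close>. The weights
  in \<open>energy\<close> are such that these two contributions cancel.\<close>

lemma has_real_derivative_energy:
  fixes X X' G :: "real \<Rightarrow> 'a::real_inner"
  assumes t: "t > 0" and c: "c = (r + 1) / 2 - b"
    and X: "(X has_vector_derivative X' t) (at t)"
    and X': "(X' has_vector_derivative A) (at t)"
    and G: "(G has_vector_derivative B) (at t)"
    and F: "(F has_real_derivative X' t \<bullet> G t) (at t)"
    and ode: "A + ((r + 1) / t) *\<^sub>R X' t + (b * \<sigma>) *\<^sub>R B
      + (1 + (r + 1) * \<sigma> / (2 * t)) *\<^sub>R G t = 0"
  shows "(energy r b C c \<sigma> F X X' G xs has_real_derivative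
      (2 * t + (C + c) * \<sigma>) * F t
      - (t + C * \<sigma>) / t * (t + c * \<sigma>) * r * (G t \<bullet> (X t - xs))
      - (t + C * \<sigma>) * (t + c * \<sigma>) * (b * \<sigma>) * (norm (G t))\<^sup>2
      - C * \<sigma> / (2 * t\<^sup>2) * (norm (r *\<^sub>R (X t - xs) + t *\<^sub>R (X' t + (b * \<sigma>) *\<^sub>R G t)))\<^sup>2) (at t)"
proof -
  define Z where "Z u = r *\<^sub>R (X u - xs) + u *\<^sub>R (X' u + (b * \<sigma>) *\<^sub>R G u)" for u
  have "(Z has_vector_derivative
      r *\<^sub>R X' t + (t *\<^sub>R (A + (b * \<sigma>) *\<^sub>R B) + (X' t + (b * \<sigma>) *\<^sub>R G t))) (at t)"
    unfolding Z_def by (auto intro!: derivative_eq_intros X X' G)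
  \<comment> \<open>Multiplying the equation by \<open>t\<close> eliminates \<open>A\<close> and
    \<open>B\<close> together. The coefficients of \<open>X' t\<close> sum to
    \<open>r + 1 - (r + 1) = 0\<close>, and those of \<open>G t\<close> to
    \<open>-(t + (r + 1) / 2 * \<sigma>) + b * \<sigma>\<close>, which explains
    \<open>c\<close>.\<close>
  moreover have "r *\<^sub>R X' t + (t *\<^sub>R (A + (b * \<sigma>) *\<^sub>R B) + (X' t + (b * \<sigma>) *\<^sub>R G t))
      = - (t + c * \<sigma>) *\<^sub>R G t"
  proof -
    have "A + (b * \<sigma>) *\<^sub>R B = - ((r + 1) / t) *\<^sub>R X' t - (1 + (r + 1) * \<sigma> / (2 * t)) *\<^sub>R G t"
      using ode by (simp add: algebra_simps eq_neg_iff_add_eq_0)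
    then have "t *\<^sub>R (A + (b * \<sigma>) *\<^sub>R B)
        = (t * - ((r + 1) / t)) *\<^sub>R X' t - (t * (1 + (r + 1) * \<sigma> / (2 * t))) *\<^sub>R G t"
      by (simp only: scaleR_diff_right scaleR_scaleR)
    also have "t * - ((r + 1) / t) = - (r + 1)"
      using t by simp
    also have "t * (1 + (r + 1) * \<sigma> / (2 * t)) = t + (r + 1) / 2 * \<sigma>"
      using t by (simp add: field_simps)
    finally show ?thesis
      by (simp add: c algebra_simps)
  qed
  ultimately have Z: "(Z has_vector_derivative - (t + c * \<sigma>) *\<^sub>R G t) (at t)"
    by simp
  have N: "((\<lambda>u. Z u \<bullet> Z u) has_real_derivative 2 * (- (t + c * \<sigma>) * (G t \<bullet> Z t))) (at t)"
    using has_derivative_inner[OF Z[unfolded has_vector_derivative_def]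
        Z[unfolded has_vector_derivative_def]]
    unfolding has_field_derivative_def
    by (elim back_subst[where P = "\<lambda>d. (_ has_derivative d) _"])
      (simp add: fun_eq_iff inner_commute algebra_simps)
  \<comment> \<open>The weight is \<open>1 + C * \<sigma> / u\<close>; its derivative yields the
    last term of the result, which has a favourable sign when
    \<open>C * \<sigma> \<ge> 0\<close>.\<close>
  have q: "((\<lambda>u. (u + C * \<sigma>) / u) has_real_derivative - (C * \<sigma>) / t\<^sup>2) (at t)"
    using t by (auto intro!: derivative_eq_intros simp: power2_eq_square field_simps)
  have E: "((\<lambda>u. (u + C * \<sigma>) * (u + c * \<sigma>) * F u + (u + C * \<sigma>) / u * (1 / 2 * (Z u \<bullet> Z u)))
      has_real_derivative
      ((2 * t + (C + c) * \<sigma>) * F t + (t + C * \<sigma>) * (t + c * \<sigma>) * (X' t \<bullet> G t)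
       + (- (C * \<sigma>) / t\<^sup>2 * (1 / 2 * (Z t \<bullet> Z t))
       + (t + C * \<sigma>) / t * (1 / 2 * (2 * (- (t + c * \<sigma>) * (G t \<bullet> Z t))))))) (at t)"
    by (rule derivative_eq_intros F N q refl | simp add: algebra_simps)+
  have GZ: "G t \<bullet> Z t = r * (G t \<bullet> (X t - xs)) + t * (X' t \<bullet> G t) + t * (b * \<sigma>) * (norm (G t))\<^sup>2"
    by (simp add: Z_def inner_add_right power2_norm_eq_inner inner_commute algebra_simps)
  have energy: "energy r b C c \<sigma> F X X' G xs
      = (\<lambda>u. (u + C * \<sigma>) * (u + c * \<sigma>) * F u + (u + C * \<sigma>) / u * (1 / 2 * (Z u \<bullet> Z u)))"
    by (simp add: energy_def fun_eq_iff Z_def power2_norm_eq_inner)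
  show ?thesis
    unfolding Z_def[symmetric] power2_norm_eq_inner[of "Z t"] energy
    by (rule back_subst[where P = "\<lambda>d. (_ has_real_derivative d) _", OF E[unfolded GZ]])
      (use t in \<open>simp add: field_simps power2_eq_square[of t]\<close>)
qed

section \<open>A threshold for the time, in units of \<open>sqrt s\<close>\<close>

text \<open>The summand \<open>(r + 1) / 2\<close> reaches the start time, \<open>1\<close> makes
  this strict, and \<open>2 * c\<close> ensures that the shift by \<open>c * \<sigma>\<close> costs
  at most half of \<open>t\<close>. The last summand controls the coefficient of \<open>F\<close>;
  its first form blows up as \<open>r\<close> tends to 2, hence the case split.\<close>

definition decay_time :: "real \<Rightarrow> real \<Rightarrow> real" where
  "decay_time r b = (let c = \<bar>(r + 1) / 2 - b\<bar> in
     (r + 1) / 2 + 1 + 2 * c + (if r > 2 then (r - 1) * c / (r - 2) else 2 * b * c))"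

text \<open>By the last inequality, \<open>f(X) - f\<^sup>*\<close> enters the upper bound for \<open>V'\<close> with a nonpositive coefficient.\<close>

lemma decay_time_estimates:
  assumes r: "r \<ge> 2" and b: "b \<ge> 0" and \<sigma>: "\<sigma> > 0" and t: "t \<ge> decay_time r b * \<sigma>"
    and c: "c = (r + 1) / 2 - b" and C: "C = (if r > 2 then 0 else b)"
  shows "t > (r + 1) / 2 * \<sigma>" "t + c * \<sigma> \<ge> t / 2"
    "2 * t + (C + c) * \<sigma> \<le> (t + C * \<sigma>) / t * (t + c * \<sigma>) * r"
proof -
  define e where "e = (if r > 2 then (r - 1) * \<bar>c\<bar> / (r - 2) else 2 * b * \<bar>c\<bar>)"
  have e: "e \<ge> 0" using r b by (simp add: e_def)
  have t': "t \<ge> (r + 1) / 2 * \<sigma> + \<sigma> + 2 * \<bar>c\<bar> * \<sigma> + e * \<sigma>"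
    using t unfolding decay_time_def Let_def c[symmetric] e_def[symmetric] by (simp only: algebra_simps)
  have nn: "(r + 1) / 2 * \<sigma> \<ge> 0" "\<bar>c\<bar> * \<sigma> \<ge> 0" "e * \<sigma> \<ge> 0"
    using r \<sigma> e by simp_all
  have c\<sigma>: "- (c * \<sigma>) \<le> \<bar>c\<bar> * \<sigma>"
    using \<sigma> by (metis abs_ge_minus_self mult_minus_left mult_right_mono less_imp_le)
  show "t > (r + 1) / 2 * \<sigma>" "t + c * \<sigma> \<ge> t / 2"
    using t' nn \<sigma> c\<sigma> by linarith+
  have t0: "t > 0" and te: "t \<ge> e * \<sigma>"
    using t' nn \<sigma> by linarith+
  show "2 * t + (C + c) * \<sigma> \<le> (t + C * \<sigma>) / t * (t + c * \<sigma>) * r"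
  proof (cases "r > 2")
    case True
    \<comment> \<open>With \<open>C = 0\<close> the claim reads
      \<open>- (r - 1) * c * \<sigma> \<le> (r - 2) * t\<close>, and \<open>e\<close> is the
      threshold read off from it.\<close>
    have "(r - 1) * (\<bar>c\<bar> * \<sigma>) = (r - 2) * (e * \<sigma>)"
      using True by (simp add: e_def)
    also have "\<dots> \<le> (r - 2) * t"
      using True te by (intro mult_left_mono) auto
    finally have "(r - 1) * (\<bar>c\<bar> * \<sigma>) \<le> (r - 2) * t" .
    moreover have "(r - 1) * - (c * \<sigma>) \<le> (r - 1) * (\<bar>c\<bar> * \<sigma>)"
      using True c\<sigma> by (intro mult_left_mono) auto
    ultimately have "(r - 1) * - (c * \<sigma>) \<le> (r - 2) * t" by linarith
    then show ?thesis
      using True t0 by (simp add: C algebra_simps)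
  next
    case False
    then have r2: "r = 2" using r by simp
    \<comment> \<open>At \<open>r = 2\<close> the terms in \<open>t\<^sup>2\<close> cancel. Since
      \<open>C = b\<close> gives \<open>C + c = 3 / 2\<close>, what remains is
      \<open>3 / 2 * \<sigma> * t + 2 * b * c * \<sigma>\<^sup>2 \<ge> 0\<close>.\<close>
    have "2 * b * \<sigma> * - (c * \<sigma>) \<le> 2 * b * \<sigma> * (\<bar>c\<bar> * \<sigma>)"
      using c\<sigma> b \<sigma> by (intro mult_left_mono) auto
    also have "\<dots> = \<sigma> * (e * \<sigma>)"
      using False by (simp add: e_def)
    also have "\<dots> \<le> \<sigma> * t"
      using te \<sigma> by (intro mult_left_mono) auto
    finally have "2 * b * \<sigma> * - (c * \<sigma>) \<le> \<sigma> * t" .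
    moreover have "\<sigma> * t > 0" using \<sigma> t0 by simp
    ultimately have "(2 * t + (b + c) * \<sigma>) * t \<le> (t + b * \<sigma>) * (t + c * \<sigma>) * 2"
      unfolding c r2 by (simp add: algebra_simps power2_eq_square)
    then show ?thesis
      using t0 by (simp add: C r2 field_simps)
  qed
qed

section \<open>Decay along a solution\<close>

text \<open>The constant 6 comes from the gradient bound, where integrating
  \<open>u\<^sup>2 / 2\<close> gives \<open>u ^ 3 / 6\<close>; it also covers the constant 2 that
  the bound on \<open>f\<close> yields.\<close>

lemma ode_solution_decay:
  assumes r: "r \<ge> 2" and b: "\<beta> / \<gamma> = b" "b \<ge> 0" and s: "s > 0" and f: "f \<in> F2 n"
    and xs: "is_minimizer_on (Rn n) f xs"
    and sol: "ode_solution n f r \<beta> \<gamma> s x0 X X'"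
    and t1: "t1 = decay_time r b * sqrt s"
  defines "V \<equiv> lyapunov n f r \<beta> \<gamma> s xs X X'"
  shows "t1 \<ge> start_time r s"
    and "t > t1 \<Longrightarrow> f (X t) - f xs \<le> 6 * (V t1 / t ^ 2)"
    and "t > t1 \<Longrightarrow> b > 0 \<Longrightarrow> (INF u\<in>{t1..t}. (norm (gradient_on (Rn n) f (X u)))\<^sup>2)
          \<le> 6 * (V t1 / (b * sqrt s * (t ^ 3 - t1 ^ 3)))"
proof -
  define \<sigma> where "\<sigma> = sqrt s"
  define c where "c = (r + 1) / 2 - b"
  define C where "C = (if r > 2 then 0 else b)"
  define G where "G u = gradient_on (Rn n) f (X u)" for u
  define F where "F u = f (X u) - f xs" for u
  have \<sigma>: "\<sigma> > 0" using s by (simp add: \<sigma>_def)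
  have C0: "C \<ge> 0" using b by (simp add: C_def)
  have V: "V = energy r b C c \<sigma> F X X' G xs"
    using b(1) by (auto simp: V_def lyapunov_def energy_def fun_eq_iff Let_def lyap_C_def C_def c_def
        F_def G_def \<sigma>_def)
  have fd: "f differentiable_on Rn n" "gradient_on (Rn n) f differentiable_on Rn n"
    and conv: "convex_on (Rn n) f"
    using f by (auto simp: F2_def twice_cont_diff_on_def)
  note dt = decay_time_estimates[OF r b(2) \<sigma> _ c_def C_def]
  have start: "start_time r s = (r + 1) / 2 * \<sigma>"
    by (simp add: start_time_def \<sigma>_def)
  have tge: "u \<ge> decay_time r b * \<sigma>" "u > start_time r s" "u > 0" "u + c * \<sigma> \<ge> u / 2" if "u \<ge> t1" for u
  proof -
    show *: "u \<ge> decay_time r b * \<sigma>" using that t1 by (simp add: \<sigma>_def)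
    show "u > start_time r s" "u + c * \<sigma> \<ge> u / 2" using dt(1,2)[OF *] start by auto
    then show "u > 0" using start r \<sigma> by (smt (verit) divide_nonneg_pos mult_nonneg_nonneg)
  qed
  show "t1 \<ge> start_time r s" using tge(2)[of t1] by simp
  have F0: "F u \<ge> 0" if "u \<ge> t1" for u
    using xs sol tge(2)[OF that] by (auto simp: F_def is_minimizer_on_def ode_solution_def Let_def)
  have deriv: "\<exists>y. (V has_real_derivative y) (at u) \<and> y \<le> - (b * \<sigma> * u\<^sup>2 / 2 * (norm (G u))\<^sup>2)"
    if u: "u \<ge> t1" for u
  proof -
    note u' = tge[OF u]
    \<comment> \<open>The chain rule is applied within \<open>T\<close>, because \<open>X\<close>
      maps \<open>T\<close> into \<open>Rn n\<close>, where \<open>f\<close> and its gradient are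
      differentiable. As \<open>u\<close> lies strictly after the start time, the results are
      two-sided derivatives.\<close>
    define T where "T = {start_time r s..}"
    have int: "at u within T = at u"
      using u'(2) unfolding T_def by (intro at_within_interior) simp
    have XT: "X ` T \<subseteq> Rn n" and Xu: "X u \<in> Rn n"
      using sol u'(2) by (auto simp: ode_solution_def Let_def T_def)
    obtain A where X: "(X has_vector_derivative X' u) (at u within T)"
      and A: "(X' has_vector_derivative A) (at u within T)"
      and ode: "A + ((r + 1) / u) *\<^sub>R X' u + (b * \<sigma>) *\<^sub>R hessian_on (Rn n) f (X u) (X' u)
        + (1 + (r + 1) * \<sigma> / (2 * u)) *\<^sub>R G u = 0"
      using sol u'(2) unfolding ode_solution_def Let_def T_def \<sigma>_def G_def b(1) by (meson less_imp_le)
    note grad = gradient_on_Rn[OF fd(1) Xu]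
    have X_D: "(X has_derivative (\<lambda>h. h *\<^sub>R X' u)) (at u within T)"
      using X by (simp add: has_vector_derivative_def)
    have "((\<lambda>v. f (X v)) has_derivative (\<lambda>h. (h *\<^sub>R X' u) \<bullet> G u)) (at u within T)"
      unfolding G_def by (rule has_derivative_in_compose[OF X_D has_derivative_subset[OF grad(2) XT]])
    then have "((\<lambda>v. f (X v)) has_real_derivative X' u \<bullet> G u) (at u within T)"
      by (simp add: has_real_derivative_iff_has_vector_derivative has_vector_derivative_def)
    then have F: "(F has_real_derivative X' u \<bullet> G u) (at u)"
      unfolding F_def int by (auto intro!: derivative_eq_intros)
    have H: "(gradient_on (Rn n) f has_derivative hessian_on (Rn n) f (X u)) (at (X u) within Rn n)"
      using fd(2) Xu frechet_derivative_works
      unfolding hessian_on_def differentiable_on_def by blast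
    have "(G has_derivative (\<lambda>h. hessian_on (Rn n) f (X u) (h *\<^sub>R X' u))) (at u within T)"
      unfolding G_def by (rule has_derivative_in_compose[OF X_D has_derivative_subset[OF H XT]])
    then have G: "(G has_vector_derivative hessian_on (Rn n) f (X u) (X' u)) (at u)"
      by (simp add: int has_vector_derivative_def linear_cmul[OF has_derivative_linear[OF H]])
    have "(xs - X u) \<bullet> G u \<le> f xs - f (X u)"
      using convex_on_subspace_above_tangent[OF subspace_Rn Xu _ grad(2) conv, of xs] xs
      by (simp add: is_minimizer_on_def G_def)
    then have tangent: "F u \<le> G u \<bullet> (X u - xs)"
      by (simp add: F_def inner_commute algebra_simps)
    let ?q = "(u + C * \<sigma>) / u * (u + c * \<sigma>) * r"
    have Cu: "u + C * \<sigma> \<ge> u" using C0 \<sigma> by simp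
    \<comment> \<open>Nonnegativity of \<open>F u\<close> allows enlarging its coefficient to
      \<open>?q\<close>; convexity then makes the first two terms of the derivative of
      \<open>V\<close> sum to at most 0.\<close>
    have "(2 * u + (C + c) * \<sigma>) * F u \<le> ?q * F u"
      by (rule mult_right_mono[OF dt(3)[OF u'(1)] F0[OF u]])
    also have "\<dots> \<le> ?q * (G u \<bullet> (X u - xs))"
      using tangent u' Cu r by (intro mult_left_mono mult_nonneg_nonneg divide_nonneg_nonneg) linarith+
    finally have 1: "(2 * u + (C + c) * \<sigma>) * F u \<le> ?q * (G u \<bullet> (X u - xs))" .
    have "u * (u / 2) * (b * \<sigma>) * (norm (G u))\<^sup>2 \<le> (u + C * \<sigma>) * (u + c * \<sigma>) * (b * \<sigma>) * (norm (G u))\<^sup>2"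
      using u' Cu b \<sigma> by (intro mult_right_mono mult_mono) auto
    then have 2: "b * \<sigma> * u\<^sup>2 / 2 * (norm (G u))\<^sup>2 \<le> (u + C * \<sigma>) * (u + c * \<sigma>) * (b * \<sigma>) * (norm (G u))\<^sup>2"
      by (simp add: power2_eq_square mult_ac)
    have 3: "C * \<sigma> / (2 * u\<^sup>2) * (norm (r *\<^sub>R (X u - xs) + u *\<^sub>R (X' u + (b * \<sigma>) *\<^sub>R G u)))\<^sup>2 \<ge> 0"
      using C0 \<sigma> by simp
    show ?thesis
      unfolding V
      by (rule exI, rule conjI,
          rule has_real_derivative_energy[OF u'(3) c_def X[unfolded int] A[unfolded int] G F ode])
        (use 1 2 3 in linarith)
  qed
  have VF: "u\<^sup>2 / 2 * F u \<le> V u" if "u \<ge> t1" for u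
  proof -
    have "u * (u / 2) * F u \<le> (u + C * \<sigma>) * (u + c * \<sigma>) * F u"
      using tge[OF that] F0[OF that] C0 \<sigma> by (intro mult_right_mono mult_mono) auto
    moreover have "(u + C * \<sigma>) / u
        * (1 / 2 * (norm (r *\<^sub>R (X u - xs) + u *\<^sub>R (X' u + (b * \<sigma>) *\<^sub>R G u)))\<^sup>2) \<ge> 0"
      using tge[OF that] C0 \<sigma> by simp
    moreover have "u * (u / 2) = u\<^sup>2 / 2" by (simp add: power2_eq_square)
    ultimately show ?thesis
      unfolding V energy_def by (metis add_increasing2)
  qed
  {
    assume t: "t > t1"
    define m where "m = (INF u\<in>{t1..t}. (norm (G u))\<^sup>2)"
    have bdd: "bdd_below ((\<lambda>u. (norm (G u))\<^sup>2) ` {t1..t})"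
      by (rule bdd_belowI[of _ 0]) auto
    have m0: "m \<ge> 0" using t unfolding m_def by (intro cINF_greatest) auto
    \<comment> \<open>Integration is replaced by monotonicity: the added cubic has derivative
      \<open>b * \<sigma> * u\<^sup>2 / 2 * m\<close>, which the decrease of \<open>V\<close>
      absorbs because \<open>m\<close> is a lower bound of the squared gradient norm on the
      interval.\<close>
    have "V t + m * (b * \<sigma> / 6) * t ^ 3 \<le> V t1 + m * (b * \<sigma> / 6) * t1 ^ 3"
    proof (rule DERIV_nonpos_imp_nonincreasing[of t1 t "\<lambda>u. V u + m * (b * \<sigma> / 6) * u ^ 3"])
      show "t1 \<le> t" using t by simp
      fix u assume u: "t1 \<le> u" "u \<le> t"
      obtain y where y: "(V has_real_derivative y) (at u)"
        "y \<le> - (b * \<sigma> * u\<^sup>2 / 2 * (norm (G u))\<^sup>2)"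
        using deriv[OF u(1)] by blast
      have "m \<le> (norm (G u))\<^sup>2"
        unfolding m_def using bdd u by (intro cINF_lower) auto
      then have "b * \<sigma> * u\<^sup>2 / 2 * m \<le> b * \<sigma> * u\<^sup>2 / 2 * (norm (G u))\<^sup>2"
        using b \<sigma> by (intro mult_left_mono) auto
      moreover have "((\<lambda>u. V u + m * (b * \<sigma> / 6) * u ^ 3) has_real_derivative
          y + b * \<sigma> * u\<^sup>2 / 2 * m) (at u)"
        by (auto intro!: derivative_eq_intros y)
      ultimately show "\<exists>y. ((\<lambda>u. V u + m * (b * \<sigma> / 6) * u ^ 3) has_real_derivative y) (at u) \<and> y \<le> 0"
        using y(2) by (intro exI[of _ "y + b * \<sigma> * u\<^sup>2 / 2 * m"]) auto
    qed
    then have *: "V t + m * (b * \<sigma> / 6) * (t ^ 3 - t1 ^ 3) \<le> V t1"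
      by (simp add: algebra_simps)
    have t3: "t ^ 3 - t1 ^ 3 > 0"
      using t tge(3)[of t1] by (simp add: power_strict_mono)
    have t0: "t > 0" using tge(3)[of t] t by simp
    have nn: "m * (b * \<sigma> / 6) * (t ^ 3 - t1 ^ 3) \<ge> 0"
      using m0 b \<sigma> t3 by simp
    have VF': "t\<^sup>2 / 2 * F t \<le> V t" and Ft: "F t \<ge> 0" using VF F0 t by auto
    \<comment> \<open>The estimates give the factor 2; \<open>V t1\<close> is nonnegative, so it may
      be raised to the common constant 6.\<close>
    have "t\<^sup>2 * F t \<le> 6 * V t1"
    proof -
      have "t\<^sup>2 * F t \<ge> 0" using Ft by simp
      with VF' * nn show ?thesis by linarith
    qed
    then show "f (X t) - f xs \<le> 6 * (V t1 / t ^ 2)"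
      using t0 by (simp add: F_def field_simps)
    have "V t \<ge> 0" using VF' Ft by (meson divide_nonneg_pos mult_nonneg_nonneg order_trans zero_le_power2 zero_less_numeral)
    then have **: "m * (b * \<sigma> / 6) * (t ^ 3 - t1 ^ 3) \<le> V t1" using * by linarith
    \<comment> \<open>Everything above allows \<open>b = 0\<close>, so the bound on \<open>f\<close>
      also covers \<open>\<beta> = 0\<close>; only dividing by \<open>b\<close> asks for
      positivity.\<close>
    assume "b > 0"
    then have "b * \<sigma> * (t ^ 3 - t1 ^ 3) > 0" using \<sigma> t3 by simp
    then have "m \<le> 6 * (V t1 / (b * \<sigma> * (t ^ 3 - t1 ^ 3)))"
      using ** by (simp add: pos_le_divide_eq algebra_simps)
    then show "(INF u\<in>{t1..t}. (norm (gradient_on (Rn n) f (X u)))\<^sup>2)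
        \<le> 6 * (V t1 / (b * sqrt s * (t ^ 3 - t1 ^ 3)))"
      by (simp add: m_def G_def \<sigma>_def)
  }
qed

section \<open>Constants uniform over all dimensions, objectives and solutions\<close>

text \<open>Choosing \<open>\<tau>\<close> and \<open>K\<close> as functions of \<open>r\<close> and
  \<open>\<beta> / \<gamma>\<close>, before the dimension and all other data, expresses what the
  constants may depend on.\<close>

theorem proposition3:
  shows
    "(\<exists>\<tau> K :: real \<Rightarrow> real \<Rightarrow> real.
        \<forall>r \<beta> \<gamma> :: real. r \<ge> 2 \<and> \<gamma> \<noteq> 0 \<and> \<beta> / \<gamma> > 0 \<longrightarrow>
          K r (\<beta> / \<gamma>) > 0 \<and>
          (\<forall>(n :: nat) f (s :: real) x0 xs X X'.
             f \<in> F2 n \<and> is_minimizer_on (Rn n) f xs \<and> s > 0 \<and> x0 \<in> Rn n \<and>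
             ode_solution n f r \<beta> \<gamma> s x0 X X' \<longrightarrow>
             (let t1 = \<tau> r (\<beta> / \<gamma>) * sqrt s;
                  V = lyapunov n f r \<beta> \<gamma> s xs X X' in
                t1 \<ge> start_time r s \<and>
                (\<forall>t>t1.
                   f (X t) - f xs \<le> K r (\<beta> / \<gamma>) * (V t1 / t ^ 2) \<and>
                   (INF u\<in>{t1..t}. (norm (gradient_on (Rn n) f (X u)))\<^sup>2)
                     \<le> K r (\<beta> / \<gamma>) * (\<gamma> * V t1 / (\<beta> * sqrt s * (t ^ 3 - t1 ^ 3)))))))
     \<and>
     (\<exists>\<tau> K :: real \<Rightarrow> real \<Rightarrow> real.
        \<forall>r \<beta> \<gamma> :: real. r \<ge> 2 \<and> \<gamma> \<noteq> 0 \<and> \<beta> = 0 \<longrightarrow>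
          K r (\<beta> / \<gamma>) > 0 \<and>
          (\<forall>(n :: nat) f (s :: real) x0 xs X X'.
             f \<in> F2 n \<and> is_minimizer_on (Rn n) f xs \<and> s > 0 \<and> x0 \<in> Rn n \<and>
             ode_solution n f r \<beta> \<gamma> s x0 X X' \<longrightarrow>
             (let t1 = \<tau> r (\<beta> / \<gamma>) * sqrt s;
                  V = lyapunov n f r \<beta> \<gamma> s xs X X' in
                t1 \<ge> start_time r s \<and>
                (\<forall>t>t1. f (X t) - f xs \<le> K r (\<beta> / \<gamma>) * (V t1 / t ^ 2)))))"
proof (intro conjI)
  show "\<exists>\<tau> K :: real \<Rightarrow> real \<Rightarrow> real.
        \<forall>r \<beta> \<gamma> :: real. r \<ge> 2 \<and> \<gamma> \<noteq> 0 \<and> \<beta> / \<gamma> > 0 \<longrightarrow>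
          K r (\<beta> / \<gamma>) > 0 \<and>
          (\<forall>(n :: nat) f (s :: real) x0 xs X X'.
             f \<in> F2 n \<and> is_minimizer_on (Rn n) f xs \<and> s > 0 \<and> x0 \<in> Rn n \<and>
             ode_solution n f r \<beta> \<gamma> s x0 X X' \<longrightarrow>
             (let t1 = \<tau> r (\<beta> / \<gamma>) * sqrt s;
                  V = lyapunov n f r \<beta> \<gamma> s xs X X' in
                t1 \<ge> start_time r s \<and>
                (\<forall>t>t1.
                   f (X t) - f xs \<le> K r (\<beta> / \<gamma>) * (V t1 / t ^ 2) \<and>
                   (INF u\<in>{t1..t}. (norm (gradient_on (Rn n) f (X u)))\<^sup>2)
                     \<le> K r (\<beta> / \<gamma>) * (\<gamma> * V t1 / (\<beta> * sqrt s * (t ^ 3 - t1 ^ 3))))))"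
  \<comment> \<open>The factor in the bounds is the absolute constant 6; only the threshold varies
    with \<open>r\<close> and \<open>\<beta> / \<gamma>\<close>.\<close>
  proof (rule exI[of _ decay_time], rule exI[of _ "\<lambda>_ _. 6"], unfold Let_def, intro allI impI conjI)
    fix r \<beta> \<gamma> s t :: real and n f x0 xs X X'
    let ?t1 = "decay_time r (\<beta> / \<gamma>) * sqrt s"
    assume p: "r \<ge> 2 \<and> \<gamma> \<noteq> 0 \<and> \<beta> / \<gamma> > 0"
      and q: "f \<in> F2 n \<and> is_minimizer_on (Rn n) f xs \<and> s > 0 \<and> x0 \<in> Rn n \<and>
        ode_solution n f r \<beta> \<gamma> s x0 X X'"
    then have h: "r \<ge> 2" "\<beta> / \<gamma> \<ge> 0" "s > 0" "f \<in> F2 n" "is_minimizer_on (Rn n) f xs"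
      "ode_solution n f r \<beta> \<gamma> s x0 X X'"
      by auto
    note decay = ode_solution_decay[OF h(1) refl h(2-6) refl]
    show "?t1 \<ge> start_time r s"
      by (rule decay(1))
    assume t: "t > ?t1"
    show "f (X t) - f xs \<le> 6 * (lyapunov n f r \<beta> \<gamma> s xs X X' ?t1 / t ^ 2)"
      using t by (rule decay(2))
    have "(INF u\<in>{?t1..t}. (norm (gradient_on (Rn n) f (X u)))\<^sup>2)
        \<le> 6 * (lyapunov n f r \<beta> \<gamma> s xs X X' ?t1 / (\<beta> / \<gamma> * sqrt s * (t ^ 3 - ?t1 ^ 3)))"
      using decay(3)[OF t] p by simp
    then show "(INF u\<in>{?t1..t}. (norm (gradient_on (Rn n) f (X u)))\<^sup>2)
        \<le> 6 * (\<gamma> * lyapunov n f r \<beta> \<gamma> s xs X X' ?t1 / (\<beta> * sqrt s * (t ^ 3 - ?t1 ^ 3)))"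
      by (simp add: mult.commute)
  qed simp
next
  show "\<exists>\<tau> K :: real \<Rightarrow> real \<Rightarrow> real.
        \<forall>r \<beta> \<gamma> :: real. r \<ge> 2 \<and> \<gamma> \<noteq> 0 \<and> \<beta> = 0 \<longrightarrow>
          K r (\<beta> / \<gamma>) > 0 \<and>
          (\<forall>(n :: nat) f (s :: real) x0 xs X X'.
             f \<in> F2 n \<and> is_minimizer_on (Rn n) f xs \<and> s > 0 \<and> x0 \<in> Rn n \<and>
             ode_solution n f r \<beta> \<gamma> s x0 X X' \<longrightarrow>
             (let t1 = \<tau> r (\<beta> / \<gamma>) * sqrt s;
                  V = lyapunov n f r \<beta> \<gamma> s xs X X' in
                t1 \<ge> start_time r s \<and>
                (\<forall>t>t1. f (X t) - f xs \<le> K r (\<beta> / \<gamma>) * (V t1 / t ^ 2))))"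
  proof (rule exI[of _ decay_time], rule exI[of _ "\<lambda>_ _. 6"], unfold Let_def, intro allI impI conjI)
    fix r \<beta> \<gamma> s t :: real and n f x0 xs X X'
    let ?t1 = "decay_time r (\<beta> / \<gamma>) * sqrt s"
    assume p: "r \<ge> 2 \<and> \<gamma> \<noteq> 0 \<and> \<beta> = 0"
      and q: "f \<in> F2 n \<and> is_minimizer_on (Rn n) f xs \<and> s > 0 \<and> x0 \<in> Rn n \<and>
        ode_solution n f r \<beta> \<gamma> s x0 X X'"
    then have h: "r \<ge> 2" "\<beta> / \<gamma> \<ge> 0" "s > 0" "f \<in> F2 n" "is_minimizer_on (Rn n) f xs"
      "ode_solution n f r \<beta> \<gamma> s x0 X X'"
      by auto
    note decay = ode_solution_decay[OF h(1) refl h(2-6) refl]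
    show "?t1 \<ge> start_time r s"
      by (rule decay(1))
    assume "t > ?t1"
    then show "f (X t) - f xs \<le> 6 * (lyapunov n f r \<beta> \<gamma> s xs X X' ?t1 / t ^ 2)"
      by (rule decay(2))
  qed simp
qed

end
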